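(* Let $\mathcal{T}$ be the Markov-Cayley tree of a $d\times d$ essential $0$-$1$ matrix $M$ satisfying $\lim_{n\to\infty}\|M^{n+1}\|/\|M^{n}\|=\gamma>1$. Let $p=\frac12$. For every integer $\alpha\ge2$, the free energy function associated with the sum $S_N^{\#}(\alpha)=\sum_{i=1}^{N}\sigma_i\sigma_{i^{\alpha}}$ on $\mathcal{T}$, $$F_{\frac12}(\beta)=\limsup_{N\to\infty}\frac{\log\mathbb{E}_{\frac12}\left(e^{\beta S_N^{\#}(\alpha)}\right)}{|\Delta_{N^{\alpha}-1}|},$$ equals $$F_{\frac12}(\beta)=\frac{\gamma-1}{\gamma}\log\left[\frac12\left(e^{\beta}+e^{-\beta}\right)\right]$$ for all $\beta\in\mathbb{R}$.
   Context: Tree. Let $\Sigma=\{1,\dots,d\}$ and let $M$ be a $d\times d$ matrix with entries in $\{0,1\}$ that is essential (no zero row and no zero column). The Markov-Cayley tree $\mathcal{T}$ is the set of all finite words $x_1\cdots x_n$ over $\Sigma$ with $M(x_i,x_{i+1})=1$ for $1\le i\le n-1$, together with the empty word $\epsilon$ (the root). $\mathcal{T}_n$ is the set of words of length $n$ in $\mathcal{T}$ (the $n$-th level), $\Delta_n=\bigcup_{i=0}^{n}\mathcal{T}_i$, and $|A|$ denotes cardinality. A word $v$ is a descendant of $u$ if $u$ is a prefix of $v$ (equivalently, $u$ lies on the path from the root to $v$). For a nonnegative square matrix $A$, $\|A\|=\mathbf{1}^{t}A\mathbf{1}$ is the sum of its entries. Spins. $\mathbb{P}_p$ is the product Bernoulli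 measure on $\{+1,-1\}^{\mathcal{T}}$: the spins $(\sigma_u)_{u\in\mathcal{T}}$ are i.i.d. with $\mathbb{P}_p(\sigma_u=+1)=p$ and $\mathbb{P}_p(\sigma_u=-1)=1-p$; $\mathbb{E}_p$ is expectation. Sum. In $S_N^{\#}(\alpha)=\sum_{i=1}^{N}\sigma_i\sigma_{i^{\alpha}}$ the index $i$ refers to level $\mathcal{T}_{i-1}$, and interactions are between vertices on a common path from the root: for $i\ge2$, $\sigma_i\sigma_{i^{\alpha}}$ stands for $\sum\sigma_u\sigma_v$ over all pairs $(u,v)$ with $u\in\mathcal{T}_{i-1}$, $v\in\mathcal{T}_{i^{\alpha}-1}$ and $v$ a descendant of $u$; the $i=1$ term is $\sigma_1\sigma_1=1$. *)

theory Defs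
  imports
    "HOL-Probability.Probability"
    "HOL-Library.Sublist"
    "Jordan_Normal_Form.Matrix"
begin

text \<open>
  Matrices in this library are indexed from 0, so the alphabet of a \<open>d \<times> d\<close> matrix is
  \<open>{0..<d}\<close> rather than \<open>{1,...,d}\<close>.
\<close>

definition essential_mat :: "nat \<Rightarrow> real mat \<Rightarrow> bool" where
  "essential_mat d M \<longleftrightarrow>
     (\<forall>i<d. \<exists>j<d. M $$ (i, j) \<noteq> 0) \<and> (\<forall>j<d. \<exists>i<d. M $$ (i, j) \<noteq> 0)"

definition mc_tree :: "nat \<Rightarrow> real mat \<Rightarrow> nat list set" where
  "mc_tree d M =
     {x. set x \<subseteq> {0..<d} \<and> (\<forall>k. Suc k < length x \<longrightarrow> M $$ (x ! k, x ! Suc k) = 1)}"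

definition tree_level :: "nat \<Rightarrow> real mat \<Rightarrow> nat \<Rightarrow> nat list set" where
  "tree_level d M n = {x \<in> mc_tree d M. length x = n}"

definition tree_ball :: "nat \<Rightarrow> real mat \<Rightarrow> nat \<Rightarrow> nat list set" where
  "tree_ball d M n = (\<Union>i\<le>n. tree_level d M i)"

text \<open>
  The sample space of a single spin is exactly \<open>{1, -1}\<close>. The parameter is meant to lie in
  \<open>{0..1}\<close>; outside that range \<^const>\<open>bernoulli_pmf\<close> truncates it.
\<close>

definition spin_measure :: "real \<Rightarrow> real measure" where
  "spin_measure p =
     distr (measure_pmf (bernoulli_pmf p)) (count_space {1, -1}) (\<lambda>b. if b then 1 else -1)"

definition spin_field :: "nat \<Rightarrow> real mat \<Rightarrow> real \<Rightarrow> (nat list \<Rightarrow> real) measure" where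
  "spin_field d M p = (\<Pi>\<^sub>M u\<in>mc_tree d M. spin_measure p)"

text \<open>
  The summand of index \<open>i\<close> couples levels \<open>i - 1\<close> and \<open>i\<^sup>\<alpha> - 1\<close>, and \<open>v\<close> is a descendant of \<open>u\<close>
  when \<open>u\<close> is a prefix of \<open>v\<close>. For \<open>i = 1\<close> both vertices are the root, and the summand
  is \<open>\<sigma> [] * \<sigma> []\<close>, which is 1 on the sample space (lemma \<open>path_sum_1\<close>).
\<close>

definition path_sum :: "nat \<Rightarrow> real mat \<Rightarrow> nat \<Rightarrow> nat \<Rightarrow> (nat list \<Rightarrow> real) \<Rightarrow> real" where
  "path_sum d M \<alpha> N \<sigma> =
     (\<Sum>i = 1..N. \<Sum>(u, v) \<in> {(u, v). u \<in> tree_level d M (i - 1) \<and>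
        v \<in> tree_level d M (i ^ \<alpha> - 1) \<and> prefix u v}. \<sigma> u * \<sigma> v)"

definition free_energy :: "nat \<Rightarrow> real mat \<Rightarrow> nat \<Rightarrow> real \<Rightarrow> real \<Rightarrow> ereal" where
  "free_energy d M \<alpha> p \<beta> =
     limsup (\<lambda>N. ereal (ln (\<integral>\<sigma>. exp (\<beta> * path_sum d M \<alpha> N \<sigma>) \<partial>spin_field d M p)
                         / real (card (tree_ball d M (N ^ \<alpha> - 1)))))"

lemma prob_space_spin_measure: "prob_space (spin_measure p)"
  unfolding spin_measure_def by (rule measure_pmf.prob_space_distr) auto

lemma path_sum_1:
  assumes "\<sigma> \<in> space (spin_field d M p)"
  shows "path_sum d M \<alpha> 1 \<sigma> = 1"
proof -
  have "[] \<in> mc_tree d M" by (simp add: mc_tree_def)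
  then have s: "\<sigma> [] \<in> space (spin_measure p)"
    using assms by (auto simp: spin_field_def space_PiM)
  have s: "\<sigma> [] = 1 \<or> \<sigma> [] = - 1"
    using s by (simp add: spin_measure_def)
  have level0: "tree_level d M 0 = {[]}"
  proof (rule equalityI)
    show "tree_level d M 0 \<subseteq> {[]}" by (simp add: tree_level_def subset_iff)
    show "{[]} \<subseteq> tree_level d M 0" by (simp add: tree_level_def mc_tree_def)
  qed
  have pairs: "{(u, v). u \<in> tree_level d M (1 - 1) \<and>
      v \<in> tree_level d M (1 ^ \<alpha> - 1) \<and> prefix u v} = {([], [])}"
    unfolding power_one diff_self_eq_0 level0 by auto
  have "path_sum d M \<alpha> 1 \<sigma> = \<sigma> [] * \<sigma> []"
    unfolding path_sum_def atLeastAtMost_singleton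
    by (simp only: sum.insert finite.emptyI empty_iff sum.empty pairs not_False_eq_True prod.case add_0_right)
  then show ?thesis using s by (elim disjE) simp_all
qed
end

theory Submission
  imports Defs
begin

text \<open>
  A vertex at level \<open>i\<^sup>\<alpha> - 1\<close> has exactly one prefix at level \<open>i - 1\<close>, so it is the lower end
  of exactly one interaction. Apart from the root's interaction with itself, which contributes the
  constant 1, the interactions therefore form a forest oriented towards the root. For symmetric
  spins the products along the edges of a forest behave like independent fair signs: a deepest
  vertex \<open>v\<close> occurs in one edge only, and reversing its spin preserves the measure while it
  inverts the factor \<open>exp (\<beta> * \<sigma> u * \<sigma> v)\<close>, so this factor may be replaced by \<open>cosh \<beta>\<close>.
  Removing the edges one after the other (\<open>integral_exp_forest_energy\<close>) gives
  the expectation \<open>exp \<beta> * cosh \<beta> ^ m\<^sub>N\<close>, where \<open>m\<^sub>N\<close> is the total size of the levels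
  \<open>i\<^sup>\<alpha> - 1\<close> with \<open>2 \<le> i \<le> N\<close> (\<open>integral_exp_path_sum\<close>). It remains to see that \<open>m\<^sub>N\<close> divided by the
  size of the ball of radius \<open>N\<^sup>\<alpha> - 1\<close> tends to \<open>(\<gamma> - 1) / \<gamma>\<close>.

  This is a statement about geometric growth. Level \<open>n + 1\<close> has as many vertices as the sum of
  the entries of \<open>M\<^sup>n\<close> (\<open>card_tree_level_Suc\<close>), so consecutive level sizes have ratio tending to
  \<open>\<gamma>\<close>, and the last level takes up the fraction \<open>1 - 1 / \<gamma>\<close> of a large ball
  (\<open>term_over_partial_sum\<close>). The other summands of \<open>m\<^sub>N\<close> all lie in the ball of radius
  \<open>(N - 1)\<^sup>\<alpha> - 1\<close>. Since \<open>\<alpha> \<ge> 2\<close>, the radii \<open>N\<^sup>\<alpha> - 1\<close> have gaps that tend to infinity,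
  and this smaller ball is negligible (\<open>earlier_partial_sum_negligible\<close>).
\<close>

section \<open>Peeling leaves off a forest of spins\<close>

text \<open>
  Both sides are probability measures on the product \<open>\<sigma>\<close>-algebra, so it suffices to compare them
  on cylinders over finitely many coordinates, where the claim reduces to the factors.
\<close>

lemma (in product_prob_space) distr_PiM_coordinatewise:
  assumes meas: "\<And>i. i \<in> I \<Longrightarrow> \<tau> i \<in> measurable (M i) (M i)"
    and inv: "\<And>i. i \<in> I \<Longrightarrow> distr (M i) (M i) (\<tau> i) = M i"
  shows "distr (PiM I M) (PiM I M) (\<lambda>x. \<lambda>i\<in>I. \<tau> i (x i)) = PiM I M"
proof (rule PiM_eq)
  fix J F assume J: "finite J" "J \<subseteq> I" and F: "\<And>j. j \<in> J \<Longrightarrow> F j \<in> sets (M j)"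
  let ?T = "\<lambda>x. \<lambda>i\<in>I. \<tau> i (x i)"
  let ?G = "\<lambda>j. \<tau> j -` F j \<inter> space (M j)"
  have T: "?T \<in> measurable (PiM I M) (PiM I M)"
    by (intro measurable_restrict measurable_PiM_component_rev meas)
  have G: "?G j \<in> sets (M j)" if "j \<in> J" for j
    using meas[of j] F[of j] J that by (auto intro: measurable_sets)
  have "emeasure (distr (PiM I M) (PiM I M) ?T) (emb I J (Pi\<^sub>E J F))
      = emeasure (PiM I M) (?T -` emb I J (Pi\<^sub>E J F) \<inter> space (PiM I M))"
    using J F by (intro emeasure_distr T sets_PiM_I) auto
  also have "?T -` emb I J (Pi\<^sub>E J F) \<inter> space (PiM I M) = emb I J (Pi\<^sub>E J ?G)"
  proof -
    have "?T x \<in> emb I J (Pi\<^sub>E J F) \<longleftrightarrow> x \<in> emb I J (Pi\<^sub>E J ?G)" if x: "x \<in> space (PiM I M)" for x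
    proof -
      have "?T x \<in> space (PiM I M)" using measurable_space[OF T x] .
      then show ?thesis
        using x J by (auto simp: prod_emb_def space_PiM PiE_iff subset_iff)
    qed
    moreover have "emb I J (Pi\<^sub>E J ?G) \<subseteq> space (PiM I M)"
      by (auto simp: prod_emb_def space_PiM)
    ultimately show ?thesis by blast
  qed
  also have "emeasure (PiM I M) \<dots> = (\<Prod>j\<in>J. emeasure (M j) (?G j))"
    using J G by (intro emeasure_PiM_emb)
  also have "\<dots> = (\<Prod>j\<in>J. emeasure (distr (M j) (M j) (\<tau> j)) (F j))"
    using J F meas by (intro prod.cong refl emeasure_distr[symmetric]) auto
  also have "\<dots> = (\<Prod>j\<in>J. emeasure (M j) (F j))"
    using J inv by (intro prod.cong refl) auto
  finally show "emeasure (distr (PiM I M) (PiM I M) ?T) (emb I J (Pi\<^sub>E J F))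
      = (\<Prod>j\<in>J. emeasure (M j) (F j))" .
qed simp

lemma sets_spin_measure: "sets (spin_measure p) = Pow {1, -1}"
  by (simp add: spin_measure_def)

lemma space_spin_measure: "space (spin_measure p) = {1, -1}"
  by (simp add: spin_measure_def)

lemma measurable_spin_measure_iff:
  "f \<in> measurable (spin_measure p) N \<longleftrightarrow> f \<in> {1, -1} \<rightarrow> space N"
  by (auto simp: measurable_def sets_spin_measure space_spin_measure)

lemma fair_spin_symmetric:
  "distr (spin_measure (1/2)) (spin_measure (1/2)) uminus = spin_measure (1/2)"
proof -
  let ?g = "\<lambda>b::bool. if b then 1 else (-1::real)"
  have flip: "map_pmf Not (bernoulli_pmf (1/2)) = bernoulli_pmf (1/2)"
  proof -
    have "map_pmf Not (pmf_of_set UNIV) = pmf_of_set (Not ` UNIV)"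
      by (intro map_pmf_of_set_inj) (auto simp: inj_on_def)
    also have "Not ` UNIV = UNIV" by (auto simp: image_iff)
    finally show ?thesis by (simp add: bernoulli_pmf_half_conv_pmf_of_set)
  qed
  have "distr (spin_measure (1/2)) (spin_measure (1/2)) uminus
      = distr (spin_measure (1/2)) (count_space {1, -1}) uminus"
    by (intro distr_cong) (auto simp: sets_spin_measure)
  also have "\<dots> = distr (measure_pmf (bernoulli_pmf (1/2))) (count_space {1, -1}) (uminus \<circ> ?g)"
    unfolding spin_measure_def by (subst distr_distr) auto
  also have "uminus \<circ> ?g = ?g \<circ> Not" by auto
  also have "distr (measure_pmf (bernoulli_pmf (1/2))) (count_space {1, -1}) (?g \<circ> Not)
      = distr (measure_pmf (map_pmf Not (bernoulli_pmf (1/2)))) (count_space {1, -1}) ?g"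
    unfolding map_pmf_rep_eq by (subst distr_distr) auto
  finally show ?thesis by (simp only: flip spin_measure_def)
qed

abbreviation fair_spins :: "'a set \<Rightarrow> ('a \<Rightarrow> real) measure" where
  "fair_spins V \<equiv> (\<Pi>\<^sub>M u\<in>V. spin_measure (1/2))"

lemma product_prob_space_fair_spins: "product_prob_space (\<lambda>_. spin_measure p)"
  using prob_space_spin_measure[of p]
  by (simp add: product_prob_space_def product_sigma_finite_def product_prob_space_axioms_def
      prob_space_imp_sigma_finite)

lemma spin_cases: "\<lbrakk>\<sigma> \<in> space (fair_spins V); u \<in> V\<rbrakk> \<Longrightarrow> \<sigma> u = 1 \<or> \<sigma> u = -1"
  by (auto simp: space_PiM PiE_iff space_spin_measure)

lemma spin_measurable:
  assumes "u \<in> V" shows "(\<lambda>\<sigma>. \<sigma> u) \<in> borel_measurable (fair_spins V)"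
proof -
  have "(\<lambda>x. x) \<in> borel_measurable (spin_measure (1/2))"
    by (simp add: measurable_spin_measure_iff)
  from measurable_compose[OF measurable_component_singleton[OF assms] this] show ?thesis .
qed

text \<open>
  This invariance is what \<open>p = 1/2\<close> provides: for a biased spin the values \<open>exp \<beta>\<close> and
  \<open>exp (- \<beta>)\<close> of an edge factor would occur with weights that depend on the parent's spin.
\<close>

lemma integral_flip_spin:
  assumes v: "v \<in> V" and f: "f \<in> borel_measurable (fair_spins V)"
  shows "(\<integral>\<sigma>. f (\<sigma>(v := - \<sigma> v)) \<partial>fair_spins V) = (\<integral>\<sigma>. (f \<sigma> :: real) \<partial>fair_spins V)"
proof -
  interpret product_prob_space "\<lambda>_. spin_measure (1/2)" V
    by (rule product_prob_space_fair_spins)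
  define \<tau> :: "'a \<Rightarrow> real \<Rightarrow> real" where "\<tau> i = (if i = v then uminus else (\<lambda>x. x))" for i
  let ?T = "\<lambda>x. \<lambda>i\<in>V. \<tau> i (x i)"
  have \<tau>: "\<tau> i \<in> measurable (spin_measure (1/2)) (spin_measure (1/2))" for i
    by (auto simp: measurable_spin_measure_iff space_spin_measure \<tau>_def)
  have T: "?T \<in> measurable (fair_spins V) (fair_spins V)"
    by (intro measurable_restrict measurable_PiM_component_rev \<tau>)
  have "distr (fair_spins V) (fair_spins V) ?T = fair_spins V"
    by (intro distr_PiM_coordinatewise \<tau>)
       (auto simp: \<tau>_def fair_spin_symmetric distr_id)
  then have "(\<integral>\<sigma>. f \<sigma> \<partial>fair_spins V) = (\<integral>\<sigma>. f \<sigma> \<partial>distr (fair_spins V) (fair_spins V) ?T)"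
    by simp
  also have "\<dots> = (\<integral>\<sigma>. f (?T \<sigma>) \<partial>fair_spins V)"
    by (rule integral_distr[OF T f])
  also have "\<dots> = (\<integral>\<sigma>. f (\<sigma>(v := - \<sigma> v)) \<partial>fair_spins V)"
  proof (rule Bochner_Integration.integral_cong[OF refl])
    fix \<sigma> assume "\<sigma> \<in> space (fair_spins V)"
    then have "?T \<sigma> = \<sigma>(v := - \<sigma> v)"
      using v by (auto simp: \<tau>_def space_PiM PiE_def extensional_def restrict_def)
    then show "f (?T \<sigma>) = f (\<sigma>(v := - \<sigma> v))" by simp
  qed
  finally show ?thesis ..
qed

abbreviation spin_energy :: "('a \<times> 'a) set \<Rightarrow> ('a \<Rightarrow> real) \<Rightarrow> real" where
  "spin_energy E \<sigma> \<equiv> (\<Sum>(u, v)\<in>E. \<sigma> u * \<sigma> v)"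

lemma integrable_exp_spin_energy:
  assumes "finite E" "E \<subseteq> V \<times> V"
  shows "integrable (fair_spins V) (\<lambda>\<sigma>. exp (\<beta> * spin_energy E \<sigma>))"
proof -
  interpret product_prob_space "\<lambda>_. spin_measure (1/2)" V
    by (rule product_prob_space_fair_spins)
  have *: "\<bar>spin_energy E \<sigma>\<bar> \<le> real (card E)" if \<sigma>: "\<sigma> \<in> space (fair_spins V)" for \<sigma>
  proof -
    have "\<bar>spin_energy E \<sigma>\<bar> \<le> (\<Sum>(u, v)\<in>E. \<bar>\<sigma> u * \<sigma> v\<bar>)"
      using sum_abs[of "\<lambda>(u, v). \<sigma> u * \<sigma> v" E] by (simp add: case_prod_unfold)
    also have "\<dots> \<le> (\<Sum>e\<in>E. 1)"
    proof (rule sum_mono)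
      fix e assume "e \<in> E"
      then show "(case e of (u, v) \<Rightarrow> \<bar>\<sigma> u * \<sigma> v\<bar>) \<le> 1"
        using assms(2) spin_cases[OF \<sigma>, of "fst e"] spin_cases[OF \<sigma>, of "snd e"]
        by (cases e) (fastforce simp: abs_mult)
    qed
    finally show ?thesis by simp
  qed
  show ?thesis
  proof (rule integrable_const_bound[where B = "exp (\<bar>\<beta>\<bar> * real (card E))"])
    show "AE \<sigma> in fair_spins V. norm (exp (\<beta> * spin_energy E \<sigma>)) \<le> exp (\<bar>\<beta>\<bar> * real (card E))"
    proof (rule AE_I2)
      fix \<sigma> assume "\<sigma> \<in> space (fair_spins V)"
      then have "\<bar>\<beta> * spin_energy E \<sigma>\<bar> \<le> \<bar>\<beta>\<bar> * real (card E)"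
        using * by (simp add: abs_mult mult_left_mono)
      then show "norm (exp (\<beta> * spin_energy E \<sigma>)) \<le> exp (\<bar>\<beta>\<bar> * real (card E))" by simp
    qed
    have "(\<lambda>\<sigma>. spin_energy E \<sigma>) \<in> borel_measurable (fair_spins V)"
      unfolding case_prod_unfold using assms
      by (intro borel_measurable_sum borel_measurable_times spin_measurable) auto
    then show "(\<lambda>\<sigma>. exp (\<beta> * spin_energy E \<sigma>)) \<in> borel_measurable (fair_spins V)" by simp
  qed
qed

text \<open>
  The hypotheses describe a forest: every vertex has at most one edge \<open>(u, v)\<close> to a parent \<open>u\<close>,
  and the height \<open>h\<close> excludes cycles. The induction adds edges by increasing height of the
  child, so the child of the new edge occurs in no earlier edge and its spin can be reversed
  without affecting them.
\<close>

lemma integral_exp_forest_energy: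
  fixes h :: "'a \<Rightarrow> nat"
  assumes "finite E" "E \<subseteq> V \<times> V" "inj_on snd E" "\<And>u v. (u, v) \<in> E \<Longrightarrow> h u < h v"
  shows "(\<integral>\<sigma>. exp (\<beta> * spin_energy E \<sigma>) \<partial>fair_spins V) = cosh \<beta> ^ card E"
  using assms
proof (induction E rule: finite_ranking_induct[where f = "\<lambda>e. h (snd e)"])
  case empty
  interpret product_prob_space "\<lambda>_. spin_measure (1/2)" V
    by (rule product_prob_space_fair_spins)
  show ?case using P.prob_space by simp
next
  case (insert e S)
  have IH: "(\<integral>\<sigma>. exp (\<beta> * spin_energy S \<sigma>) \<partial>fair_spins V) = cosh \<beta> ^ card S"
    using insert.prems by (intro insert.IH) (auto simp: inj_on_def)
  show ?case
  proof (cases "e \<in> S")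
    case True
    then show ?thesis using IH by (simp add: insert_absorb)
  next
    case False
    obtain u v where e: "e = (u, v)" by fastforce
    have uv: "u \<in> V" "v \<in> V" "u \<noteq> v" using insert.prems(1) insert.prems(3)[of u v] by (auto simp: e)
    have fresh: "a \<noteq> v \<and> b \<noteq> v" if ab: "(a, b) \<in> S" for a b
    proof -
      have "h a < h b" using insert.prems(3) ab by auto
      moreover have "h b \<le> h v" using insert.hyps(2)[OF ab] by (simp add: e)
      moreover have "b \<noteq> v" using insert.prems(2) ab False by (auto simp: e inj_on_def)
      ultimately show ?thesis by auto
    qed
    let ?f = "\<lambda>\<sigma>. exp (\<beta> * spin_energy S \<sigma>)"
    let ?g = "\<lambda>\<sigma>. exp (\<beta> * spin_energy (insert e S) \<sigma>)"
    have int_f: "integrable (fair_spins V) ?f" and int_g: "integrable (fair_spins V) ?g"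
      using insert.prems(1) insert.hyps(1) by (auto intro!: integrable_exp_spin_energy)
    have flip: "?g (\<sigma>(v := - \<sigma> v)) = 2 * cosh \<beta> * ?f \<sigma> - ?g \<sigma>"
      if \<sigma>: "\<sigma> \<in> space (fair_spins V)" for \<sigma>
    proof -
      have S: "spin_energy S (\<sigma>(v := - \<sigma> v)) = spin_energy S \<sigma>"
        using fresh by (intro sum.cong) auto
      have g: "?g \<sigma>' = exp (\<beta> * (\<sigma>' u * \<sigma>' v)) * exp (\<beta> * spin_energy S \<sigma>')" for \<sigma>'
        using False insert.hyps(1) by (simp add: e ring_distribs exp_add)
      have "exp (- \<beta> * (\<sigma> u * \<sigma> v)) = 2 * cosh \<beta> - exp (\<beta> * (\<sigma> u * \<sigma> v))"
        using spin_cases[OF \<sigma> uv(1)] spin_cases[OF \<sigma> uv(2)]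
        by (elim disjE) (auto simp: cosh_field_def field_simps)
      then show ?thesis unfolding g S using uv(3) by (simp add: ring_distribs)
    qed
    \<comment> \<open>The unknown integral of \<open>?g\<close> reappears with the opposite sign and can be solved for.\<close>
    have "(\<integral>\<sigma>. ?g \<sigma> \<partial>fair_spins V) = (\<integral>\<sigma>. ?g (\<sigma>(v := - \<sigma> v)) \<partial>fair_spins V)"
      by (rule integral_flip_spin[symmetric, OF uv(2) borel_measurable_integrable[OF int_g]])
    also have "\<dots> = (\<integral>\<sigma>. 2 * cosh \<beta> * ?f \<sigma> - ?g \<sigma> \<partial>fair_spins V)"
      by (rule Bochner_Integration.integral_cong[OF refl flip])
    also have "\<dots> = 2 * cosh \<beta> * (\<integral>\<sigma>. ?f \<sigma> \<partial>fair_spins V) - (\<integral>\<sigma>. ?g \<sigma> \<partial>fair_spins V)"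
      using int_f int_g by (subst Bochner_Integration.integral_diff) auto
    finally show ?thesis using IH False insert.hyps(1) by simp
  qed
qed

section \<open>Counting vertices and edges\<close>

lemma finite_tree_level: "finite (tree_level d M n)"
  by (rule finite_subset[OF _ finite_lists_length_eq[of "{0..<d}" n]])
     (auto simp: tree_level_def mc_tree_def)

lemma mc_tree_snoc:
  assumes "y \<noteq> []"
  shows "y @ [j] \<in> mc_tree d M \<longleftrightarrow> y \<in> mc_tree d M \<and> j < d \<and> M $$ (last y, j) = 1"
proof -
  have "(\<forall>k. Suc k < length (y @ [j]) \<longrightarrow> M $$ ((y @ [j]) ! k, (y @ [j]) ! Suc k) = 1) \<longleftrightarrow>
    (\<forall>k. Suc k < length y \<longrightarrow> M $$ (y ! k, y ! Suc k) = 1) \<and> M $$ (last y, j) = 1" (is "?L \<longleftrightarrow> ?R")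
  proof
    assume L: ?L
    show ?R
    proof (intro conjI allI impI)
      fix k assume "Suc k < length y" then show "M $$ (y ! k, y ! Suc k) = 1"
        using L[rule_format, of k] by (simp add: nth_append)
    next
      show "M $$ (last y, j) = 1"
        using L[rule_format, of "length y - 1"] assms by (simp add: nth_append last_conv_nth)
    qed
  next
    assume R: ?R
    show ?L
    proof (intro allI impI)
      fix k assume k: "Suc k < length (y @ [j])"
      show "M $$ ((y @ [j]) ! k, (y @ [j]) ! Suc k) = 1"
      proof (cases "Suc k < length y")
        case True then show ?thesis using R by (simp add: nth_append)
      next
        case False
        then have "k = length y - 1" using k by simp
        then show ?thesis using R assms by (simp add: nth_append last_conv_nth)
      qed
    qed
  qed
  then show ?thesis by (auto simp: mc_tree_def)
qed

lemma take_mc_tree: "x \<in> mc_tree d M \<Longrightarrow> take k x \<in> mc_tree d M"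
  by (auto simp: mc_tree_def dest: in_set_takeD)

text \<open>
  Refining the count by the last letter turns the extension of words by one letter into
  multiplication of the row vector of column sums of \<open>M\<^sup>n\<close> by \<open>M\<close>.
\<close>

lemma card_words_ending_in:
  assumes M: "M \<in> carrier_mat d d" "elements_mat M \<subseteq> {0, 1}" and "j < d"
  shows "real (card {x \<in> tree_level d M (Suc n). last x = j}) = (\<Sum>i<d. (M ^\<^sub>m n) $$ (i, j))"
  using \<open>j < d\<close>
proof (induction n arbitrary: j)
  case 0
  have "{x \<in> tree_level d M (Suc 0). last x = j} = {[j]}"
    using 0 by (auto simp: tree_level_def mc_tree_def length_Suc_conv)
  moreover have "(\<Sum>i<d. (M ^\<^sub>m 0) $$ (i, j)) = (\<Sum>i<d. if i = j then 1 else 0)"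
    using 0 M by (intro sum.cong) auto
  ultimately show ?case using 0 by simp
next
  case (Suc n)
  let ?W = "\<lambda>n j. {x \<in> tree_level d M (Suc n). last x = j}"
  let ?K = "{k. k < d \<and> M $$ (k, j) = 1}"
  have entry: "M $$ (k, j) = 0" if "k < d" "M $$ (k, j) \<noteq> 1" for k
    using M(2) elements_matI[OF M(1) that(1) Suc.prems refl] that(2) by blast
  have "?W (Suc n) j = (\<lambda>y. y @ [j]) ` (\<Union>k\<in>?K. ?W n k)"
  proof (intro equalityI subsetI)
    fix x assume x: "x \<in> ?W (Suc n) j"
    then have "x \<noteq> []" by (auto simp: tree_level_def)
    then obtain y where y: "x = y @ [j]" using x append_butlast_last_id[of x]
      by (metis (mono_tags) mem_Collect_eq)
    have "length y = Suc n" using x y by (simp add: tree_level_def)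
    then have "y \<noteq> []" by auto
    then have "y \<in> mc_tree d M" "M $$ (last y, j) = 1" "last y < d"
      using x y last_in_set[of y] mc_tree_snoc[of y j d M]
      by (auto simp: tree_level_def) (auto simp: mc_tree_def subset_iff)
    then show "x \<in> (\<lambda>y. y @ [j]) ` (\<Union>k\<in>?K. ?W n k)"
      using y \<open>length y = Suc n\<close> by (auto simp: tree_level_def)
  next
    fix x assume "x \<in> (\<lambda>y. y @ [j]) ` (\<Union>k\<in>?K. ?W n k)"
    then obtain y where y: "x = y @ [j]" "y \<in> mc_tree d M" "length y = Suc n" "M $$ (last y, j) = 1"
      by (auto simp: tree_level_def)
    then have "y \<noteq> []" by auto
    then show "x \<in> ?W (Suc n) j" using y Suc.prems by (auto simp: tree_level_def mc_tree_snoc)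
  qed
  then have "card (?W (Suc n) j) = card (\<Union>k\<in>?K. ?W n k)"
    by (simp add: card_image inj_on_def)
  also have "\<dots> = (\<Sum>k\<in>?K. card (?W n k))"
    using finite_tree_level by (intro card_UN_disjoint) auto
  finally have "real (card (?W (Suc n) j)) = (\<Sum>k\<in>?K. real (card (?W n k)))" by simp
  also have "\<dots> = (\<Sum>k<d. (\<Sum>i<d. (M ^\<^sub>m n) $$ (i, k)) * M $$ (k, j))"
    by (rule sum.mono_neutral_cong_left) (auto simp: Suc.IH entry)
  also have "\<dots> = (\<Sum>i<d. \<Sum>k<d. (M ^\<^sub>m n) $$ (i, k) * M $$ (k, j))"
    unfolding sum_distrib_right by (rule sum.swap)
  also have "\<dots> = (\<Sum>i<d. (M ^\<^sub>m Suc n) $$ (i, j))"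
  proof (rule sum.cong[OF refl])
    fix i assume "i \<in> {..<d}"
    then show "(\<Sum>k<d. (M ^\<^sub>m n) $$ (i, k) * M $$ (k, j)) = (M ^\<^sub>m Suc n) $$ (i, j)"
      using M Suc.prems pow_carrier_mat[OF M(1), of n]
      by (simp add: scalar_prod_def atLeast0LessThan)
  qed
  finally show ?case .
qed

lemma card_tree_level_Suc:
  assumes M: "M \<in> carrier_mat d d" "elements_mat M \<subseteq> {0, 1}"
  shows "real (card (tree_level d M (Suc n))) = sum_mat (M ^\<^sub>m n)"
proof -
  have "last x < d" if "x \<in> tree_level d M (Suc n)" for x
  proof -
    have "x \<noteq> []" "set x \<subseteq> {0..<d}" using that by (auto simp: tree_level_def mc_tree_def)
    then show ?thesis using last_in_set[of x] by (simp add: subset_iff)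
  qed
  then have "tree_level d M (Suc n) = (\<Union>j<d. {x \<in> tree_level d M (Suc n). last x = j})"
    by blast
  moreover have "card (\<Union>j<d. {x \<in> tree_level d M (Suc n). last x = j})
      = (\<Sum>j<d. card {x \<in> tree_level d M (Suc n). last x = j})"
    using finite_tree_level by (intro card_UN_disjoint) auto
  ultimately have "real (card (tree_level d M (Suc n)))
      = (\<Sum>j<d. \<Sum>i<d. (M ^\<^sub>m n) $$ (i, j))"
    using card_words_ending_in[OF M] by simp
  also have "\<dots> = (\<Sum>i<d. \<Sum>j<d. (M ^\<^sub>m n) $$ (i, j))"
    by (rule sum.swap)
  also have "\<dots> = sum_mat (M ^\<^sub>m n)"
    using M(1) carrier_matD[OF pow_carrier_mat[OF M(1), of n]]
    by (simp add: sum_mat_def sum.cartesian_product atLeast0LessThan del: pow_mat_dim)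
  finally show ?thesis .
qed

lemma card_tree_ball: "card (tree_ball d M n) = (\<Sum>i\<le>n. card (tree_level d M i))"
  unfolding tree_ball_def using finite_tree_level
  by (intro card_UN_disjoint) (auto simp: tree_level_def)

definition descent_pairs :: "nat \<Rightarrow> real mat \<Rightarrow> nat \<Rightarrow> nat \<Rightarrow> (nat list \<times> nat list) set" where
  "descent_pairs d M k n =
     {(u, v). u \<in> tree_level d M k \<and> v \<in> tree_level d M n \<and> prefix u v}"

text \<open>The upper vertex is determined by the lower one, since prefixes of given length are unique.\<close>

lemma descent_pairs_eq_image:
  assumes "k \<le> n"
  shows "descent_pairs d M k n = (\<lambda>v. (take k v, v)) ` tree_level d M n"
proof -
  have "u = take (length u) v" if "prefix u v" for u v :: "nat list"
    using that by (auto simp: prefix_def)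
  then show ?thesis
    using assms by (auto simp: descent_pairs_def tree_level_def take_mc_tree take_is_prefix)
qed

lemma finite_descent_pairs: "k \<le> n \<Longrightarrow> finite (descent_pairs d M k n)"
  by (simp add: descent_pairs_eq_image finite_tree_level)

lemma card_descent_pairs: "k \<le> n \<Longrightarrow> card (descent_pairs d M k n) = card (tree_level d M n)"
  by (simp add: descent_pairs_eq_image card_image inj_on_def)

text \<open>
  The index starts at 2: for \<open>i = 1\<close> the pair is a loop at the root, which would violate the
  forest condition.
\<close>

definition path_edges :: "nat \<Rightarrow> real mat \<Rightarrow> nat \<Rightarrow> nat \<Rightarrow> (nat list \<times> nat list) set" where
  "path_edges d M \<alpha> N = (\<Union>i\<in>{2..N}. descent_pairs d M (i - 1) (i ^ \<alpha> - 1))"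

lemma level_gap:
  fixes i :: nat assumes "2 \<le> i" "2 \<le> \<alpha>" shows "i - 1 < i ^ \<alpha> - 1"
proof -
  have "i ^ 1 < i ^ \<alpha>" using assms by (intro power_strict_increasing) auto
  then show ?thesis using assms(1) by simp
qed

lemma path_edges_disjoint:
  "i \<in> {2..N} \<Longrightarrow> j \<in> {2..N} \<Longrightarrow> i \<noteq> j \<Longrightarrow>
    descent_pairs d M (i - 1) m \<inter> descent_pairs d M (j - 1) n = {}"
  by (auto simp: descent_pairs_def tree_level_def)

lemma card_path_edges:
  assumes "2 \<le> \<alpha>"
  shows "card (path_edges d M \<alpha> N) = (\<Sum>i=2..N. card (tree_level d M (i ^ \<alpha> - 1)))"
proof -
  have gap: "i - 1 \<le> i ^ \<alpha> - 1" if "i \<in> {2..N}" for i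
    using level_gap[of i \<alpha>] assms that by simp
  have "card (path_edges d M \<alpha> N) = (\<Sum>i=2..N. card (descent_pairs d M (i - 1) (i ^ \<alpha> - 1)))"
    unfolding path_edges_def
    by (intro card_UN_disjoint ballI impI finite_descent_pairs gap path_edges_disjoint) auto
  also have "\<dots> = (\<Sum>i=2..N. card (tree_level d M (i ^ \<alpha> - 1)))"
    by (intro sum.cong card_descent_pairs gap refl)
  finally show ?thesis .
qed

lemma path_sum_eq_spin_energy:
  assumes "2 \<le> \<alpha>" "1 \<le> N" and \<sigma>: "\<sigma> \<in> space (spin_field d M p)"
  shows "path_sum d M \<alpha> N \<sigma> = 1 + spin_energy (path_edges d M \<alpha> N) \<sigma>"
proof -
  let ?s = "\<lambda>i. spin_energy (descent_pairs d M (i - 1) (i ^ \<alpha> - 1)) \<sigma>"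
  have gap: "i - 1 \<le> i ^ \<alpha> - 1" if "i \<in> {2..N}" for i
    using level_gap[of i \<alpha>] assms that by simp
  have "{1..N} = insert 1 {2..N}" using assms(2) by auto
  then have "path_sum d M \<alpha> N \<sigma> = ?s 1 + (\<Sum>i=2..N. ?s i)"
    unfolding path_sum_def descent_pairs_def[symmetric] by simp
  also have "?s 1 = path_sum d M \<alpha> 1 \<sigma>"
    unfolding path_sum_def descent_pairs_def[symmetric] by simp
  also have "path_sum d M \<alpha> 1 \<sigma> = 1" by (rule path_sum_1[OF \<sigma>])
  also have "(\<Sum>i=2..N. ?s i) = spin_energy (path_edges d M \<alpha> N) \<sigma>"
    unfolding path_edges_def
    by (intro sum.UNION_disjoint[symmetric] ballI impI finite_descent_pairs gap
        path_edges_disjoint) auto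
  finally show ?thesis .
qed

text \<open>
  Distinct indices \<open>i\<close> give distinct levels \<open>i\<^sup>\<alpha> - 1\<close>, so the length of the lower vertex
  recovers \<open>i\<close>, and with it the length of the upper vertex.
\<close>

lemma path_edges_forest:
  assumes "2 \<le> \<alpha>"
  shows "finite (path_edges d M \<alpha> N)" "path_edges d M \<alpha> N \<subseteq> mc_tree d M \<times> mc_tree d M"
    and "inj_on snd (path_edges d M \<alpha> N)"
    and "(u, v) \<in> path_edges d M \<alpha> N \<Longrightarrow> length u < length v"
proof -
  note gap = level_gap[OF _ assms]
  show "finite (path_edges d M \<alpha> N)"
    unfolding path_edges_def using gap
    by (intro finite_UN_I finite_descent_pairs) (auto intro: less_imp_le)
  show "path_edges d M \<alpha> N \<subseteq> mc_tree d M \<times> mc_tree d M"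
    by (auto simp: path_edges_def descent_pairs_def tree_level_def)
  show "length u < length v" if "(u, v) \<in> path_edges d M \<alpha> N"
    using that gap by (auto simp: path_edges_def descent_pairs_def tree_level_def)
  show "inj_on snd (path_edges d M \<alpha> N)"
  proof (rule inj_onI, clarsimp)
    fix u u' v assume "(u, v) \<in> path_edges d M \<alpha> N" "(u', v) \<in> path_edges d M \<alpha> N"
    then obtain i j where ij: "2 \<le> i" "2 \<le> j" "length u = i - 1" "length u' = j - 1"
        "i ^ \<alpha> - 1 = j ^ \<alpha> - 1" and pre: "prefix u v" "prefix u' v"
      by (auto simp: path_edges_def descent_pairs_def tree_level_def)
    have "0 < i ^ \<alpha>" "0 < j ^ \<alpha>" using ij by auto
    then have "i ^ \<alpha> = j ^ \<alpha>" using ij(5) by linarith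
    then have "i = j" using assms power_inject_base[of i "\<alpha> - 1" j] by simp
    then show "u = u'" using ij pre by (metis prefix_length_prefix order_refl prefix_order.eq_iff)
  qed
qed

lemma integral_exp_path_sum:
  assumes "2 \<le> \<alpha>" "1 \<le> N"
  shows "(\<integral>\<sigma>. exp (\<beta> * path_sum d M \<alpha> N \<sigma>) \<partial>spin_field d M (1/2))
    = exp \<beta> * cosh \<beta> ^ (\<Sum>i=2..N. card (tree_level d M (i ^ \<alpha> - 1)))"
proof -
  have "(\<integral>\<sigma>. exp (\<beta> * path_sum d M \<alpha> N \<sigma>) \<partial>spin_field d M (1/2))
      = (\<integral>\<sigma>. exp \<beta> * exp (\<beta> * spin_energy (path_edges d M \<alpha> N) \<sigma>) \<partial>spin_field d M (1/2))"
    by (rule Bochner_Integration.integral_cong[OF refl])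
       (simp add: path_sum_eq_spin_energy[OF assms] ring_distribs exp_add)
  also have "\<dots> = exp \<beta> * cosh \<beta> ^ card (path_edges d M \<alpha> N)"
    using integral_exp_forest_energy[OF path_edges_forest[OF assms(1)], where \<beta> = \<beta>]
    by (simp add: spin_field_def)
  finally show ?thesis by (simp only: card_path_edges[OF assms(1)])
qed

section \<open>Sequences of geometric growth\<close>

text \<open>
  From some index on, the map contracts by a fixed factor \<open>c < 1\<close> and the perturbation is at most
  \<open>(1 - c) * \<epsilon> / 2\<close>, so that \<open>\<epsilon> / 2\<close> is the fixed point of the majorising recursion
  \<open>x \<mapsto> c * x + (1 - c) * \<epsilon> / 2\<close>.
\<close>

lemma perturbed_contraction_tendsto_0:
  fixes e q \<delta> :: "nat \<Rightarrow> real"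
  assumes rec: "\<forall>\<^sub>F n in sequentially. e (Suc n) = q n * e n + \<delta> n"
    and q: "q \<longlonglongrightarrow> l" "\<bar>l\<bar> < 1" and \<delta>: "\<delta> \<longlonglongrightarrow> 0"
  shows "e \<longlonglongrightarrow> 0"
proof (rule LIMSEQ_I)
  fix \<epsilon> :: real assume \<epsilon>: "0 < \<epsilon>"
  obtain c where c: "\<bar>l\<bar> < c" "c < 1" using q(2) dense by blast
  have "\<forall>\<^sub>F n in sequentially. \<bar>q n\<bar> < c"
    using order_tendstoD(2)[OF tendsto_rabs[OF q(1)] c(1)] .
  moreover have "\<forall>\<^sub>F n in sequentially. \<bar>\<delta> n\<bar> < (1 - c) * (\<epsilon> / 2)"
    using order_tendstoD(2)[OF tendsto_rabs[OF \<delta>], of "(1 - c) * (\<epsilon> / 2)"] c \<epsilon> by simp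
  ultimately have "\<forall>\<^sub>F n in sequentially. e (Suc n) = q n * e n + \<delta> n \<and> \<bar>q n\<bar> < c
      \<and> \<bar>\<delta> n\<bar> < (1 - c) * (\<epsilon> / 2)"
    using rec by eventually_elim auto
  then obtain N where N: "e (Suc n) = q n * e n + \<delta> n" "\<bar>q n\<bar> < c"
      "\<bar>\<delta> n\<bar> < (1 - c) * (\<epsilon> / 2)" if "N \<le> n" for n
    unfolding eventually_sequentially by blast
  have bound: "\<bar>e (N + k)\<bar> \<le> c ^ k * \<bar>e N\<bar> + \<epsilon> / 2" for k
  proof (induction k)
    case 0 then show ?case using \<epsilon> by simp
  next
    case (Suc k)
    have "\<bar>e (N + Suc k)\<bar> \<le> \<bar>q (N + k)\<bar> * \<bar>e (N + k)\<bar> + \<bar>\<delta> (N + k)\<bar>"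
      using N(1)[of "N + k"] abs_triangle_ineq[of "q (N + k) * e (N + k)" "\<delta> (N + k)"]
      by (simp add: abs_mult)
    also have "\<dots> \<le> c * (c ^ k * \<bar>e N\<bar> + \<epsilon> / 2) + (1 - c) * (\<epsilon> / 2)"
      using N(2,3)[of "N + k"] Suc c by (intro add_mono mult_mono) auto
    finally show ?case by (simp add: field_simps)
  qed
  have "(\<lambda>k. c ^ k * \<bar>e N\<bar>) \<longlonglongrightarrow> 0"
    using c by (intro tendsto_mult_left_zero LIMSEQ_power_zero) auto
  then have "\<forall>\<^sub>F k in sequentially. c ^ k * \<bar>e N\<bar> < \<epsilon> / 2"
    using \<epsilon> by (auto dest: order_tendstoD(2)[of _ _ _ "\<epsilon> / 2"])
  then obtain K where K: "c ^ k * \<bar>e N\<bar> < \<epsilon> / 2" if "K \<le> k" for k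
    unfolding eventually_sequentially by blast
  show "\<exists>n0. \<forall>n\<ge>n0. norm (e n - 0) < \<epsilon>"
  proof (intro exI allI impI)
    fix n assume "N + K \<le> n"
    then show "norm (e n - 0) < \<epsilon>"
      using bound[of "n - N"] K[of "n - N"] by (simp add: le_diff_conv2)
  qed
qed

locale geometric_growth =
  fixes t :: "nat \<Rightarrow> real" and \<gamma> :: real
  assumes nonneg: "0 \<le> t n"
    and ratio: "(\<lambda>n. t (Suc n) / t n) \<longlonglongrightarrow> \<gamma>"
    and gt_1: "1 < \<gamma>"
begin

lemma eventually_increasing: "\<forall>\<^sub>F n in sequentially. 0 < t n \<and> t n \<le> t (Suc n)"
  using order_tendstoD(1)[OF ratio gt_1]
proof eventually_elim
  case (elim n)
  then have "t n \<noteq> 0" by auto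
  then have "0 < t n" using nonneg[of n] by simp
  then show ?case using elim by (simp add: field_simps)
qed

text \<open>
  The quotients \<open>r n\<close> of partial sum and last term satisfy \<open>r (n + 1) = 1 + r n * t n / t (n + 1)\<close>,
  and the limit is the fixed point \<open>L\<close> of \<open>L = 1 + L / \<gamma>\<close>. The deviation from it obeys a
  contracting recursion with factor close to \<open>1 / \<gamma>\<close>.
\<close>

lemma partial_sum_over_term: "(\<lambda>n. (\<Sum>i\<le>n. t i) / t n) \<longlonglongrightarrow> \<gamma> / (\<gamma> - 1)"
proof -
  let ?D = "\<lambda>n. \<Sum>i\<le>n. t i" and ?L = "\<gamma> / (\<gamma> - 1)"
  have q: "(\<lambda>n. t n / t (Suc n)) \<longlonglongrightarrow> 1 / \<gamma>"
    using tendsto_inverse[OF ratio] gt_1 by (simp add: inverse_eq_divide)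
  have "(\<lambda>n. ?D n / t n - ?L) \<longlonglongrightarrow> 0"
  proof (rule perturbed_contraction_tendsto_0[OF _ q])
    show "\<forall>\<^sub>F n in sequentially. ?D (Suc n) / t (Suc n) - ?L
        = t n / t (Suc n) * (?D n / t n - ?L) + ?L * (t n / t (Suc n) - 1 / \<gamma>)"
      using eventually_increasing
    proof eventually_elim
      case (elim n)
      have "?L = 1 + ?L / \<gamma>" using gt_1 by (simp add: field_simps)
      moreover have "?D (Suc n) / t (Suc n) = 1 + ?D n / t (Suc n)"
        using elim by (simp add: field_simps)
      moreover have "t n / t (Suc n) * (?D n / t n) = ?D n / t (Suc n)"
        using elim by simp
      moreover have "t n / t (Suc n) * (?D n / t n - ?L) + ?L * (t n / t (Suc n) - 1 / \<gamma>)
          = t n / t (Suc n) * (?D n / t n) - ?L / \<gamma>"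
      proof -
        have "x * (y - L) + L * (x - 1 / \<gamma>) = x * y - L / \<gamma>" for x y L :: real
          by (simp add: ring_distribs)
        then show ?thesis .
      qed
      ultimately show ?case by linarith
    qed
    show "(\<lambda>n. ?L * (t n / t (Suc n) - 1 / \<gamma>)) \<longlonglongrightarrow> 0"
      using q by (intro tendsto_mult_right_zero) (simp add: LIM_zero_iff)
    show "\<bar>1 / \<gamma>\<bar> < 1" using gt_1 by simp
  qed
  then show ?thesis by (simp add: LIM_zero_iff)
qed

lemma term_over_partial_sum: "(\<lambda>n. t n / (\<Sum>i\<le>n. t i)) \<longlonglongrightarrow> (\<gamma> - 1) / \<gamma>"
  using tendsto_inverse[OF partial_sum_over_term] gt_1 by simp

text \<open>
  Indices with gaps that tend to infinity; the application has \<open>a n = n\<^sup>\<alpha> - 1\<close>.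
\<close>

context
  fixes a :: "nat \<Rightarrow> nat"
  assumes gap: "a n + n \<le> a (Suc n)"
begin

lemma gap_at_top: "filterlim a at_top sequentially"
proof -
  have "n \<le> a (Suc n)" for n using gap[of n] by linarith
  then have "filterlim (\<lambda>n. a (Suc n)) at_top sequentially"
    by (intro filterlim_at_top_mono[OF filterlim_ident]) auto
  then show ?thesis by (simp only: filterlim_sequentially_Suc)
qed

lemma gap_mono: "m \<le> n \<Longrightarrow> a m \<le> a n"
proof (rule lift_Suc_mono_le[of a])
  show "a n \<le> a (Suc n)" for n using gap[of n] by linarith
qed

lemma gap_inj: "inj_on a {2..n}"
proof (rule linorder_inj_onI')
  fix i j assume "i \<in> {2..n}" "j \<in> {2..n}" "i < j"
  then have "a i < a (Suc i)" "a (Suc i) \<le> a j" using gap[of i] gap_mono[of "Suc i" j] by auto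
  then show "a i \<noteq> a j" by simp
qed

text \<open>
  Beyond \<open>a n\<close> there are at least \<open>n\<close> further terms up to index \<open>a (n + 1)\<close>, each at least
  \<open>t (a n)\<close> because the sequence is eventually increasing. The partial sum up to \<open>a n\<close> is itself
  only a bounded multiple of \<open>t (a n)\<close>, so the quotient is of order \<open>1 / n\<close>.
\<close>

lemma earlier_partial_sum_negligible:
  "(\<lambda>n. (\<Sum>i\<le>a n. t i) / (\<Sum>i\<le>a (Suc n). t i)) \<longlonglongrightarrow> 0"
proof -
  let ?D = "\<lambda>n. \<Sum>i\<le>n. t i"
  obtain n0 where n0: "0 < t n" "t n \<le> t (Suc n)" if "n0 \<le> n" for n
    using eventually_increasing unfolding eventually_sequentially by blast
  have mono: "t m \<le> t n" if "n0 \<le> m" "m \<le> n" for m n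
    using that(2,1) by (induction n rule: dec_induct) (auto intro: order_trans[OF _ n0(2)])
  have bound: "?D (a n) / ?D (a (Suc n)) \<le> ?D (a n) / t (a n) * (1 / real n)"
    if n: "n0 \<le> a n" "0 < n" for n
  proof -
    have "real n * t (a n) = (\<Sum>i\<in>{a n<..a n + n}. t (a n))" by simp
    also have "\<dots> \<le> (\<Sum>i\<in>{a n<..a n + n}. t i)"
      using n by (intro sum_mono mono) auto
    also have "\<dots> \<le> ?D (a (Suc n))"
      using gap[of n] nonneg by (intro sum_mono2) auto
    finally have "real n * t (a n) \<le> ?D (a (Suc n))" .
    moreover have "0 < real n * t (a n)" using n n0(1) by simp
    ultimately have "?D (a n) / ?D (a (Suc n)) \<le> ?D (a n) / (real n * t (a n))"
      using nonneg by (intro frac_le sum_nonneg) auto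
    then show ?thesis by (simp add: field_simps)
  qed
  have "(\<lambda>n. ?D (a n) / t (a n) * (1 / real n)) \<longlonglongrightarrow> \<gamma> / (\<gamma> - 1) * 0"
    by (intro tendsto_mult lim_1_over_n filterlim_compose[OF partial_sum_over_term gap_at_top])
  then have lim: "(\<lambda>n. ?D (a n) / t (a n) * (1 / real n)) \<longlonglongrightarrow> 0" by simp
  have "\<forall>\<^sub>F n in sequentially. n0 \<le> a n"
    using gap_at_top by (simp add: filterlim_at_top)
  then have "\<forall>\<^sub>F n in sequentially. ?D (a n) / ?D (a (Suc n)) \<le> ?D (a n) / t (a n) * (1 / real n)"
    using eventually_gt_at_top[of 0] by eventually_elim (rule bound)
  moreover have "\<forall>\<^sub>F n in sequentially. 0 \<le> ?D (a n) / ?D (a (Suc n))"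
    using nonneg by (intro always_eventually allI divide_nonneg_nonneg sum_nonneg) auto
  ultimately show ?thesis
    by (intro tendsto_sandwich[OF _ _ tendsto_const lim])
qed

lemma sparse_sum_over_partial_sum:
  "(\<lambda>n. (\<Sum>i=2..n. t (a i)) / (\<Sum>i\<le>a n. t i)) \<longlonglongrightarrow> (\<gamma> - 1) / \<gamma>"
proof -
  let ?D = "\<lambda>n. \<Sum>i\<le>n. t i"
  have sparse_le: "(\<Sum>i=2..n. t (a i)) \<le> ?D (a n)" for n
  proof -
    have "(\<Sum>i=2..n. t (a i)) = sum t (a ` {2..n})"
      by (simp add: sum.reindex[OF gap_inj])
    also have "\<dots> \<le> ?D (a n)"
      using nonneg gap_mono by (intro sum_mono2) auto
    finally show ?thesis .
  qed
  have D_nonneg: "0 \<le> ?D n" for n using nonneg by (intro sum_nonneg) auto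
  \<comment> \<open>All summands but the last are terms of the preceding partial sum.\<close>
  have rest: "(\<lambda>n. (\<Sum>i=2..n. t (a i)) / ?D (a (Suc n))) \<longlonglongrightarrow> 0"
    using nonneg sparse_le D_nonneg
    by (intro tendsto_sandwich[OF _ _ tendsto_const earlier_partial_sum_negligible]
        always_eventually allI divide_right_mono divide_nonneg_nonneg sum_nonneg) auto
  have "(\<lambda>n. t (a (Suc n)) / ?D (a (Suc n))) \<longlonglongrightarrow> (\<gamma> - 1) / \<gamma>"
    by (rule filterlim_compose[OF term_over_partial_sum])
       (use gap_at_top in \<open>simp only: filterlim_sequentially_Suc\<close>)
  from tendsto_add[OF rest this]
  have lim: "(\<lambda>n. (\<Sum>i=2..n. t (a i)) / ?D (a (Suc n)) + t (a (Suc n)) / ?D (a (Suc n)))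
      \<longlonglongrightarrow> (\<gamma> - 1) / \<gamma>" by simp
  have "(\<lambda>n. (\<Sum>i=2..Suc n. t (a i)) / ?D (a (Suc n))) \<longlonglongrightarrow> (\<gamma> - 1) / \<gamma>"
    using lim
    by (rule Lim_transform_eventually)
       (auto simp: eventually_sequentially add_divide_distrib intro!: exI[of _ 1])
  then show ?thesis by (subst (asm) filterlim_sequentially_Suc)
qed

end

end

section \<open>The free energy\<close>

lemma power_gap:
  fixes n \<alpha> :: nat assumes "2 \<le> \<alpha>" shows "n ^ \<alpha> - 1 + n \<le> Suc n ^ \<alpha> - 1"
proof (cases "n = 0")
  case False
  obtain b where b: "\<alpha> = Suc (Suc b)" using assms by (metis numeral_2_eq_2 Suc_le_D Suc_le_mono)
  have "n * 1 \<le> n * n ^ b" using False by (intro mult_le_mono) auto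
  then have "n ^ \<alpha> + n \<le> n ^ \<alpha> + n ^ Suc b" by simp
  also have "\<dots> = Suc n * n ^ Suc b" by (simp add: b)
  also have "\<dots> \<le> Suc n * Suc n ^ Suc b" by (intro mult_le_mono power_mono) auto
  finally have "n ^ \<alpha> + n \<le> Suc n ^ \<alpha>" by (simp add: b)
  moreover have "0 < n ^ \<alpha>" using False by simp
  ultimately show ?thesis by linarith
qed (use assms in \<open>simp add: power_0_left\<close>)

theorem corollary1p2:
  fixes d :: nat and M :: "real mat" and \<gamma> \<beta> :: real and \<alpha> :: nat
  assumes "M \<in> carrier_mat d d"
    and "elements_mat M \<subseteq> {0, 1}"
    and "essential_mat d M"
    and "(\<lambda>n. sum_mat (M ^\<^sub>m (n + 1)) / sum_mat (M ^\<^sub>m n)) \<longlonglongrightarrow> \<gamma>"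
    and "\<gamma> > 1"
    and "\<alpha> \<ge> 2"
  shows "free_energy d M \<alpha> (1 / 2) \<beta> =
           ereal ((\<gamma> - 1) / \<gamma> * ln (1 / 2 * (exp \<beta> + exp (- \<beta>))))"
proof -
  define t where "t n = real (card (tree_level d M n))" for n
  define a where "a n = n ^ \<alpha> - 1" for n :: nat
  let ?D = "\<lambda>n. \<Sum>i\<le>n. t i"
  have cosh: "1 / 2 * (exp \<beta> + exp (- \<beta>)) = cosh \<beta>" by (simp add: cosh_field_def)
  have "(\<lambda>n. t (Suc (Suc n)) / t (Suc n)) \<longlonglongrightarrow> \<gamma>"
    using assms(4) card_tree_level_Suc[OF assms(1,2)] by (simp add: t_def del: pow_mat.simps)
  then have "(\<lambda>n. t (Suc n) / t n) \<longlonglongrightarrow> \<gamma>"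
    by (subst (asm) filterlim_sequentially_Suc)
  then interpret geometric_growth t \<gamma>
    using assms(5) by unfold_locales (auto simp: t_def)
  have gap: "a n + n \<le> a (Suc n)" for n
    unfolding a_def by (rule power_gap[OF assms(6)])
  have D_ge_1: "1 \<le> ?D n" for n
  proof -
    have "tree_level d M 0 = {[]}" by (auto simp: tree_level_def mc_tree_def)
    then have "1 = t 0" by (simp add: t_def)
    also have "\<dots> \<le> ?D n" using nonneg by (intro member_le_sum) auto
    finally show ?thesis .
  qed
  \<comment> \<open>The root makes every ball nonempty, so \<open>1 / ?D (a (Suc n))\<close> is below the quotient of
    consecutive balls, which vanishes in the limit.\<close>
  have "(\<lambda>n. 1 / ?D (a (Suc n))) \<longlonglongrightarrow> 0"
    using D_ge_1 order_trans[OF zero_le_one D_ge_1]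
    by (intro tendsto_sandwich[OF _ _ tendsto_const earlier_partial_sum_negligible[OF gap]]
        always_eventually allI divide_right_mono) auto
  then have "(\<lambda>n. 1 / ?D (a n)) \<longlonglongrightarrow> 0"
    by (subst (asm) filterlim_sequentially_Suc)
  then have "(\<lambda>N. \<beta> * (1 / ?D (a N)) + (\<Sum>i=2..N. t (a i)) / ?D (a N) * ln (cosh \<beta>))
      \<longlonglongrightarrow> \<beta> * 0 + (\<gamma> - 1) / \<gamma> * ln (cosh \<beta>)"
    by (intro tendsto_intros sparse_sum_over_partial_sum gap)
  moreover have "\<forall>\<^sub>F N in sequentially.
      \<beta> * (1 / ?D (a N)) + (\<Sum>i=2..N. t (a i)) / ?D (a N) * ln (cosh \<beta>)
      = ln (\<integral>\<sigma>. exp (\<beta> * path_sum d M \<alpha> N \<sigma>) \<partial>spin_field d M (1/2))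
          / real (card (tree_ball d M (N ^ \<alpha> - 1)))"
    using eventually_ge_at_top[of 1]
  proof eventually_elim
    case (elim N)
    have "ln (\<integral>\<sigma>. exp (\<beta> * path_sum d M \<alpha> N \<sigma>) \<partial>spin_field d M (1/2))
        = \<beta> + (\<Sum>i=2..N. t (a i)) * ln (cosh \<beta>)"
      unfolding integral_exp_path_sum[OF assms(6) elim]
      by (simp add: ln_mult ln_realpow cosh_real_pos t_def a_def)
    then show ?case
      by (simp add: card_tree_ball t_def a_def add_divide_distrib)
  qed
  ultimately have "(\<lambda>N. ln (\<integral>\<sigma>. exp (\<beta> * path_sum d M \<alpha> N \<sigma>) \<partial>spin_field d M (1/2))
          / real (card (tree_ball d M (N ^ \<alpha> - 1))))
      \<longlonglongrightarrow> (\<gamma> - 1) / \<gamma> * ln (cosh \<beta>)"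
    using Lim_transform_eventually by fastforce
  then have "free_energy d M \<alpha> (1/2) \<beta> = ereal ((\<gamma> - 1) / \<gamma> * ln (cosh \<beta>))"
    unfolding free_energy_def by (intro lim_imp_Limsup) auto
  then show ?thesis by (simp only: cosh)
qed

end
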